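(* Let $s>0$ and let $X_1^{\mathbb C}\subset\mathbb C^2$ be the parallelotope centered at the origin and spanned (over $\mathbb R$) by the vectors $(0,2)$, $(0,2i)$, $(s\zeta,s\zeta)$, $(s\overline\zeta,s\overline\zeta)$, where $\zeta=1+i$. Let $X_2^{\mathbb C}$ be the image of $X_1^{\mathbb C}$ under $(z_1,z_2)\mapsto(-z_2,z_1)$. Then, under the identification of $\mathbb C^2$ with $\mathbb R^4$ by $(x_1+iy_1,x_2+iy_2)\leftrightarrow(x_1,x_2,y_1,y_2)$, the polytope $Y=X_1^{\mathbb C}\cap X_2^{\mathbb C}$ (the fixed island of the complex octagonal PET at parameter $s$) is $E_4$-semiregular, that is, invariant under the group $W^*$.
   Context: $W^*$ is the finite group of linear isometries of $\mathbb R^4$ generated by the reflections in the hyperplanes through the origin orthogonal to the $24$ vectors $\pm 2e_1,\pm 2e_2,\pm 2e_3,\pm 2e_4$ and $(\pm1,\pm1,\pm1,\pm1)$ (the $E_4$ Weyl group, up to conjugacy; it has order $192$). A polytope in $\mathbb R^4$ is called $E_4$-semiregular if it is invariant under $W^*$. *)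

theory Defs
  imports "HOL-Analysis.Analysis" "HOL-Algebra.Bij" "HOL-Algebra.Generated_Groups"
begin

text \<open>Orthogonal reflection in the hyperplane through the origin orthogonal to \<open>v\<close>
  (for \<open>v \<noteq> 0\<close>).\<close>

definition reflection :: "'a::real_inner \<Rightarrow> 'a \<Rightarrow> 'a" where
  "reflection v = (\<lambda>x. x - (2 * (x \<bullet> v) / (v \<bullet> v)) *\<^sub>R v)"

definition E4_roots :: "(real^4) set" where
  "E4_roots = {axis i c |i c. c = 2 \<or> c = -2} \<union> {v. \<forall>i. v $ i = 1 \<or> v $ i = -1}"

text \<open>The group \<open>W\<^sup>*\<close>. Its elements are actual maps of \<open>\<real>\<^sup>4\<close>: on \<^term>\<open>UNIV\<close> the
  extensionality built into \<^const>\<open>BijGroup\<close> is vacuous and its multiplication is composition.\<close>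

definition E4_Weyl_group :: "(real^4 \<Rightarrow> real^4) set" where
  "E4_Weyl_group = generate (BijGroup UNIV) (reflection ` E4_roots)"

definition E4_semiregular :: "(real^4) set \<Rightarrow> bool" where
  "E4_semiregular P \<longleftrightarrow> polytope P \<and> (\<forall>g\<in>E4_Weyl_group. g ` P = P)"

text \<open>The listed vectors are the edge vectors, so the coefficients range over an interval
  of length 1.\<close>

definition centered_parallelotope :: "'a::real_vector list \<Rightarrow> 'a set" where
  "centered_parallelotope vs =
     {(\<Sum>k<length vs. t k *\<^sub>R vs ! k) |t. \<forall>k<length vs. \<bar>t k\<bar> \<le> (1/2 :: real)}"

definition zeta :: complex where
  "zeta = 1 + \<i>"

definition X1 :: "real \<Rightarrow> (complex \<times> complex) set" where
  "X1 s = centered_parallelotope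
     [(0, 2), (0, 2 * \<i>),
      (of_real s * zeta, of_real s * zeta),
      (of_real s * cnj zeta, of_real s * cnj zeta)]"

definition X2 :: "real \<Rightarrow> (complex \<times> complex) set" where
  "X2 s = (\<lambda>(z1, z2). (- z2, z1)) ` X1 s"

definition C2_to_R4 :: "complex \<times> complex \<Rightarrow> real^4" where
  "C2_to_R4 = (\<lambda>(z1, z2). vector [Re z1, Re z2, Im z1, Im z2])"

end

theory Submission
  imports Defs
begin

text \<open>The island is the intersection of the slabs \<open>\<bar>x\<^sub>i \<plusminus> x\<^sub>j\<bar> \<le> 1\<close> for \<open>{i,j} = {1,2}, {3,4}\<close> and
  \<open>\<bar>x\<^sub>i \<plusminus> x\<^sub>j\<bar> \<le> s\<close> for \<open>{i,j} = {1,3}, {2,4}\<close>. Up to sign of the normals, each of these two families is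
  permuted by every generating reflection: a sign change fixes or exchanges \<open>e\<^sub>i + e\<^sub>j\<close> and \<open>e\<^sub>i - e\<^sub>j\<close>, and
  a reflection in \<open>(\<plusminus>1,\<plusminus>1,\<plusminus>1,\<plusminus>1)\<close> fixes a normal orthogonal to its root and otherwise moves it to a
  normal supported on the complementary pair of coordinates.\<close>

lemma reflection_reflection [simp]: "reflection v (reflection v x) = x"
  \<comment> \<open>At \<open>v = 0\<close> the formula is the identity, so the equation holds for
    every \<open>v\<close>.\<close>
  by (cases "v = 0") (simp_all add: reflection_def inner_diff_left algebra_simps)

lemma reflection_in_Bij: "reflection v \<in> Bij UNIV"
  by (auto simp: Bij_def intro!: o_bij[of "reflection v"])

lemma image_eq_if_involution_maps_to:
  assumes "\<And>x. f (f x) = x" and "\<And>x. x \<in> A \<Longrightarrow> f x \<in> A"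
  shows "f ` A = A"
  using assms by (metis image_eqI image_subsetI subsetI subset_antisym)

text \<open>The bijections mapping \<open>A\<close> onto itself form a subgroup. The induction
  carries membership in \<open>Bij UNIV\<close> along because inverses and products in
  \<open>BijGroup\<close> are those of functions only there.\<close>

lemma generate_BijGroup_image_eq:
  assumes g: "g \<in> generate (BijGroup UNIV) H"
    and H: "\<And>h. h \<in> H \<Longrightarrow> h \<in> Bij UNIV" "\<And>h. h \<in> H \<Longrightarrow> h ` A = A"
  shows "g ` A = A"
proof -
  have "g \<in> Bij UNIV \<and> g ` A = A"
    using g
  proof (induction rule: generate.induct)
    case one
    show ?case by (auto simp: BijGroup_def Bij_def bij_id[unfolded id_def])
  next
    case (incl h)
    then show ?case using H by blast
  next
    case (inv h)
    then have h: "bij h" "h ` A = A" and eq: "inv\<^bsub>BijGroup UNIV\<^esub> h = inv_into UNIV h"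
      using H by (auto simp: inv_BijGroup Bij_def)
    have "inv_into UNIV h ` A = A"
      using h by (metis bij_is_inj image_inv_f_f)
    then show ?case
      using h by (simp add: eq Bij_def bij_imp_bij_inv)
  next
    case (eng h k)
    then show ?case
      by (auto simp: BijGroup_def Bij_def compose_def bij_comp[unfolded comp_def] image_image[symmetric])
  qed
  then show ?thesis ..
qed

lemma polyhedron_slab: "polyhedron {x. \<bar>a \<bullet> x\<bar> \<le> b}" for a :: "'a::euclidean_space"
proof -
  have "{x. \<bar>a \<bullet> x\<bar> \<le> b} = {x. a \<bullet> x \<le> b} \<inter> {x. a \<bullet> x \<ge> - b}"
    by auto
  then show ?thesis
    by (simp add: polyhedron_halfspace_le polyhedron_halfspace_ge)
qed

lemma abs_add_abs_le_iff: "\<bar>a\<bar> + \<bar>b\<bar> \<le> c \<longleftrightarrow> \<bar>a + b\<bar> \<le> c \<and> \<bar>a - b\<bar> \<le> c" for a b c :: real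
  by linarith

text \<open>Each condition merges the two slabs with normals e_i + e_j and e_i - e_j. Only absolute
  values of coordinates remain, which sign changes do not alter.\<close>

definition E4_island :: "real \<Rightarrow> (real^4) set" where
  "E4_island s = {x. \<bar>x$1\<bar> + \<bar>x$2\<bar> \<le> 1 \<and> \<bar>x$3\<bar> + \<bar>x$4\<bar> \<le> 1 \<and> \<bar>x$1\<bar> + \<bar>x$3\<bar> \<le> s \<and> \<bar>x$2\<bar> + \<bar>x$4\<bar> \<le> s}"

lemma polytope_E4_island: "polytope (E4_island s)"
proof -
  have poly: "polyhedron {x::real^4. \<bar>x$i\<bar> + \<bar>x$j\<bar> \<le> c}" for i j c
  proof -
    have "{x::real^4. \<bar>x$i\<bar> + \<bar>x$j\<bar> \<le> c}
        = {x. \<bar>(axis i 1 + axis j 1) \<bullet> x\<bar> \<le> c} \<inter> {x. \<bar>(axis i 1 - axis j 1) \<bullet> x\<bar> \<le> c}"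
      by (auto simp: inner_add_left inner_diff_left inner_axis' abs_add_abs_le_iff)
    then show ?thesis
      by (simp only: polyhedron_slab polyhedron_Int)
  qed
  have "E4_island s \<subseteq> cbox (- 1) 1"
    by (auto simp: E4_island_def mem_box_cart forall_4)
  then have "bounded (E4_island s)"
    using bounded_cbox bounded_subset by blast
  moreover have "polyhedron (E4_island s)"
    unfolding E4_island_def Collect_conj_eq by (intro polyhedron_Int poly)
  ultimately show ?thesis
    by (simp add: polytope_eq_bounded_polyhedron)
qed

lemma reflection_E4_island:
  assumes v: "v \<in> E4_roots" and x: "x \<in> E4_island s"
  shows "reflection v x \<in> E4_island s"
  using v unfolding E4_roots_def
proof
  assume "v \<in> {axis i c |i c. c = 2 \<or> c = - 2}"
  then obtain i c where v: "v = axis i c" and c: "c = 2 \<or> c = -2" by blast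
  have "axis i c $ j = (if j = i then c else 0)" for j :: 4
    by (simp add: axis_def)
  then have "\<bar>reflection v x $ j\<bar> = \<bar>x $ j\<bar>" for j
    using c by (auto simp: v reflection_def inner_axis inner_axis_axis)
  then show ?thesis
    using x by (simp add: E4_island_def)
next
  assume "v \<in> {v. \<forall>i. v $ i = 1 \<or> v $ i = - 1}"
  then have v: "v$k = 1 \<or> v$k = - 1" for k
    by auto
  \<comment> \<open>Weighting by the signs \<open>v$k\<close> reduces to the root (1,1,1,1): up to
    sign, the reflection subtracts \<open>m\<close>, half the sum of the \<open>y k\<close>, from
    each \<open>y k\<close>.\<close>
  define y where "y k = v$k * x$k" for k
  define m where "m = (x \<bullet> v) / 2"
  have m: "2 * m = y 1 + y 2 + y 3 + y 4"
    by (simp add: m_def y_def inner_vec_def sum_4 mult.commute)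
  have abs_y: "\<bar>y k\<bar> = \<bar>x$k\<bar>" for k
    using v[of k] by (auto simp: y_def)
  have "v$k * v$k = 1" for k
    using v[of k] by auto
  then have "v \<bullet> v = 4"
    by (simp add: inner_vec_def)
  then have "reflection v x $ k = x$k - m * v$k" for k
    by (simp add: reflection_def m_def)
  then have "\<bar>reflection v x $ k\<bar> = \<bar>y k - m\<bar>" for k
    using v[of k] by (auto simp: y_def)
  \<comment> \<open>Here (a - m) + (b - m) = -(a' + b') and (a - m) - (b - m) = a - b, both at most
    \<open>c\<close> in absolute value. The values a', b' belong to the complementary pair of
    coordinates.\<close>
  moreover have "\<bar>a - m\<bar> + \<bar>b - m\<bar> \<le> c"
    if "\<bar>a\<bar> + \<bar>b\<bar> \<le> c" "\<bar>a'\<bar> + \<bar>b'\<bar> \<le> c" "2 * m = a + b + a' + b'" for a b a' b' c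
    using that by linarith
  ultimately show ?thesis
    using x m abs_y by (simp add: E4_island_def) (smt (verit))
qed

text \<open>The spanning vectors decouple the coefficients: z2 - z1 = 2 (t 0 + i t 1), Re z1 + Im z1
  = 2 s t 2 and Re z1 - Im z1 = 2 s t 3. Each bound 1/2 on a coefficient thus becomes one
  slab.\<close>

lemma mem_X1_iff:
  assumes "s > 0"
  shows "(z1, z2) \<in> X1 s \<longleftrightarrow>
    \<bar>Re z1\<bar> + \<bar>Im z1\<bar> \<le> s \<and> \<bar>Re z2 - Re z1\<bar> \<le> 1 \<and> \<bar>Im z2 - Im z1\<bar> \<le> 1"
proof
  assume "(z1, z2) \<in> X1 s"
  then obtain t :: "nat \<Rightarrow> real" where "\<forall>k<4. \<bar>t k\<bar> \<le> 1/2"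
    and z: "(z1, z2) = t 0 *\<^sub>R (0, 2) + t 1 *\<^sub>R (0, 2 * \<i>)
      + t 2 *\<^sub>R (of_real s * zeta, of_real s * zeta)
      + t 3 *\<^sub>R (of_real s * cnj zeta, of_real s * cnj zeta)"
    unfolding X1_def centered_parallelotope_def by (auto simp: eval_nat_numeral)
  then have t: "\<bar>t 0\<bar> \<le> 1/2" "\<bar>t 1\<bar> \<le> 1/2" "\<bar>t 2\<bar> \<le> 1/2" "\<bar>t 3\<bar> \<le> 1/2"
    by simp_all
  have "Re z1 + Im z1 = 2 * (s * t 2)" "Re z1 - Im z1 = 2 * (s * t 3)"
      "Re z2 - Re z1 = 2 * t 0" "Im z2 - Im z1 = 2 * t 1"
    using z by (simp_all add: zeta_def)
  moreover have "\<bar>2 * (s * t 2)\<bar> \<le> s" "\<bar>2 * (s * t 3)\<bar> \<le> s" "\<bar>2 * t 0\<bar> \<le> 1" "\<bar>2 * t 1\<bar> \<le> 1"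
    using t assms by (simp_all add: abs_mult)
  ultimately show "\<bar>Re z1\<bar> + \<bar>Im z1\<bar> \<le> s \<and> \<bar>Re z2 - Re z1\<bar> \<le> 1 \<and> \<bar>Im z2 - Im z1\<bar> \<le> 1"
    by (simp only: abs_add_abs_le_iff)
next
  assume R: "\<bar>Re z1\<bar> + \<bar>Im z1\<bar> \<le> s \<and> \<bar>Re z2 - Re z1\<bar> \<le> 1 \<and> \<bar>Im z2 - Im z1\<bar> \<le> 1"
  \<comment> \<open>The only possible coefficients, obtained by solving the four linear relations
    for \<open>t\<close>.\<close>
  define t :: "nat \<Rightarrow> real" where "t = (!) [(Re z2 - Re z1) / 2, (Im z2 - Im z1) / 2,
    (Re z1 + Im z1) / (2 * s), (Re z1 - Im z1) / (2 * s)]"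
  then have t: "t 0 = (Re z2 - Re z1) / 2" "t 1 = (Im z2 - Im z1) / 2"
      "t 2 = (Re z1 + Im z1) / (2 * s)" "t 3 = (Re z1 - Im z1) / (2 * s)"
    by simp_all
  have "\<bar>t 0\<bar> \<le> 1/2" "\<bar>t 1\<bar> \<le> 1/2" "\<bar>t 2\<bar> \<le> 1/2" "\<bar>t 3\<bar> \<le> 1/2"
    using R assms unfolding t abs_add_abs_le_iff by (simp_all add: abs_divide)
  then have "\<forall>k<4. \<bar>t k\<bar> \<le> 1/2"
    by (simp add: eval_nat_numeral All_less_Suc)
  moreover have "s * t 2 + s * t 3 = Re z1" "s * t 2 - s * t 3 = Im z1"
    using assms unfolding t by (simp_all add: field_simps)
  then have "(z1, z2) = t 0 *\<^sub>R (0, 2) + t 1 *\<^sub>R (0, 2 * \<i>)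
      + t 2 *\<^sub>R (of_real s * zeta, of_real s * zeta)
      + t 3 *\<^sub>R (of_real s * cnj zeta, of_real s * cnj zeta)"
    using t(1,2) by (simp add: zeta_def complex_eq_iff algebra_simps)
  ultimately show "(z1, z2) \<in> X1 s"
    unfolding X1_def centered_parallelotope_def
    by (intro CollectI exI[of _ t]) (simp add: eval_nat_numeral)
qed

lemma mem_X2_iff: "(z1, z2) \<in> X2 s \<longleftrightarrow> (z2, - z1) \<in> X1 s"
  unfolding X2_def by (force simp: image_iff)

lemma C2_to_R4_nth [simp]:
  "C2_to_R4 (z1, z2) $ 1 = Re z1" "C2_to_R4 (z1, z2) $ 2 = Re z2"
  "C2_to_R4 (z1, z2) $ 3 = Im z1" "C2_to_R4 (z1, z2) $ 4 = Im z2"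
  by (simp_all add: C2_to_R4_def vector_def)

text \<open>\<open>X1\<close> and \<open>X2\<close> each supply one of the bounds by
  \<open>s\<close>. For real and for imaginary parts, \<open>X1\<close> bounds the difference by 1
  and \<open>X2\<close> the sum, which together are the bounds by 1.\<close>

lemma C2_to_R4_image_eq: "C2_to_R4 ` (X1 s \<inter> X2 s) = E4_island s" if "s > 0"
proof -
  have abs_iff: "\<bar>a\<bar> + \<bar>b\<bar> \<le> 1 \<longleftrightarrow> \<bar>b - a\<bar> \<le> 1 \<and> \<bar>- a - b\<bar> \<le> 1" for a b :: real
    by linarith
  have iff: "(z1, z2) \<in> X1 s \<inter> X2 s \<longleftrightarrow> C2_to_R4 (z1, z2) \<in> E4_island s" for z1 z2
    by (auto simp: mem_X1_iff[OF that] mem_X2_iff E4_island_def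
      abs_iff[of "Re z1" "Re z2"] abs_iff[of "Im z1" "Im z2"])
  \<comment> \<open>An explicit preimage of \<open>x\<close>: as \<open>C2_to_R4\<close> is onto,
    the membership equivalence yields equality of sets.\<close>
  have "C2_to_R4 (Complex (x$1) (x$3), Complex (x$2) (x$4)) = x" for x
    by (simp add: vec_eq_iff forall_4)
  then show ?thesis
    using iff by (smt (verit, best) image_eqI image_subsetI subsetI subset_antisym surj_pair)
qed

theorem mainTheorem8:
  fixes s :: real
  assumes "s > 0"
  shows "E4_semiregular (C2_to_R4 ` (X1 s \<inter> X2 s))"
proof -
  have invariant: "reflection v ` E4_island s = E4_island s" if "v \<in> E4_roots" for v
    using that by (intro image_eq_if_involution_maps_to reflection_reflection reflection_E4_island)
  have "g ` E4_island s = E4_island s" if "g \<in> E4_Weyl_group" for g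
    using that unfolding E4_Weyl_group_def
    by (rule generate_BijGroup_image_eq) (elim imageE; simp add: reflection_in_Bij invariant)+
  then show ?thesis
    by (simp add: C2_to_R4_image_eq[OF assms] E4_semiregular_def polytope_E4_island)
qed

end
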